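(* Let $A=\{\mathbf a_1,\ldots,\mathbf a_m\}\subset\mathbb Z^n$ be a vector configuration such that $\mathbb NA$ is pointed, and let $I_A\subset K[x_1,\ldots,x_m]$ be its toric ideal. The ideal $I_A$ is generated by its indispensable binomials if and only if the Betti $A$-degrees $\mathbf b_1,\ldots,\mathbf b_q$ of $I_A$ are minimal binomial $A$-degrees and $\beta_{0,\mathbf b_i}=1$ (for all $i$).
   Context: $K$ is a field. $\mathbb NA=\{l_1\mathbf a_1+\cdots+l_m\mathbf a_m : l_i\in\mathbb N\}$ with $0\in\mathbb N$; $\mathbb NA$ is pointed if zero is its only invertible element. The $A$-degree of $\mathbf x^{\mathbf u}=x_1^{u_1}\cdots x_m^{u_m}$ is $\deg_A(\mathbf x^{\mathbf u})=u_1\mathbf a_1+\cdots+u_m\mathbf a_m$. The toric ideal $I_A$ is the ideal generated by all binomials $\mathbf x^{\mathbf u}-\mathbf x^{\mathbf v}$ with $\deg_A(\mathbf x^{\mathbf u})=\deg_A(\mathbf x^{\mathbf v})$; for such a binomial, $\deg_A(\mathbf x^{\mathbf u}-\mathbf x^{\mathbf v}):=\deg_A(\mathbf x^{\mathbf u})$. Partial order on $\mathbb NA$: $\mathbf c\ge\mathbf d$ iff $\mathbf c=\mathbf d+\mathbf e$ for some $\mathbf e\in\mathbb NA$. For $I_A\ne\{0\}$, the minimal binomial $A$-degrees are the minimal elements, with respect to $\ge$, of the set of $A$-degrees of (nonzero) binomials in $I_A$. $\mathbf b\in\mathbb NA$ is a Betti $A$-degree if $I_A$ has a minimal generating set containing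 an element of $A$-degree $\mathbf b$; the $A$-graded Betti number $\beta_{0,\mathbf b}$ is the number of times $\mathbf b$ appears as the $A$-degree of a binomial in a given minimal generating set of $I_A$ (both notions are independent of the choice of minimal generating set). A binomial $B\in I_A$ is indispensable if every system of binomial generators of $I_A$ contains $B$ or $-B$. *)

theory Defs
  imports "HOL-Library.Poly_Mapping" "HOL-Analysis.Finite_Cartesian_Product"
begin

text \<open>
  The polynomial ring \<open>K[x\<^sub>i | i \<in> 'm]\<close> is the monoid algebra of the exponent vectors
  \<open>'m \<Rightarrow>\<^sub>0 nat\<close>, where \<open>'m\<close> is a finite type indexing the vectors of the configuration.
\<close>

type_synonym ('m, 'k) mpoly = "('m \<Rightarrow>\<^sub>0 nat) \<Rightarrow>\<^sub>0 'k"

abbreviation monomial :: "('m \<Rightarrow>\<^sub>0 nat) \<Rightarrow> ('m, 'k::field) mpoly"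
  where "monomial u \<equiv> Poly_Mapping.single u 1"

text \<open>Ideals are the submodules of the ring regarded as a module over itself.\<close>

abbreviation ideal_generated :: "'r::comm_ring_1 set \<Rightarrow> 'r set"
  where "ideal_generated \<equiv> module.span (*)"

definition NA :: "('m::finite \<Rightarrow> int ^ 'n) \<Rightarrow> (int ^ 'n) set"
  where "NA a = {c. \<exists>l :: 'm \<Rightarrow> nat. c = (\<Sum>i\<in>UNIV. int (l i) *s a i)}"

definition pointed :: "'a::group_add set \<Rightarrow> bool"
  where "pointed M \<longleftrightarrow> (\<forall>c\<in>M. - c \<in> M \<longrightarrow> c = 0)"

definition A_ge :: "('m::finite \<Rightarrow> int ^ 'n) \<Rightarrow> int ^ 'n \<Rightarrow> int ^ 'n \<Rightarrow> bool"
  where "A_ge a c d \<longleftrightarrow> (\<exists>e\<in>NA a. c = d + e)"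

definition A_degree :: "('m::finite \<Rightarrow> int ^ 'n) \<Rightarrow> ('m \<Rightarrow>\<^sub>0 nat) \<Rightarrow> int ^ 'n"
  where "A_degree a u = (\<Sum>i\<in>UNIV. int (Poly_Mapping.lookup u i) *s a i)"

definition toric_ideal :: "('m::finite \<Rightarrow> int ^ 'n) \<Rightarrow> ('m, 'k::field) mpoly set"
  where "toric_ideal a =
    ideal_generated {monomial u - monomial v |u v. A_degree a u = A_degree a v}"

text \<open>Binomials are nonzero differences of two monomials, both with coefficient one.\<close>

definition is_binomial :: "('m, 'k::field) mpoly \<Rightarrow> bool"
  where "is_binomial B \<longleftrightarrow> (\<exists>u v. u \<noteq> v \<and> B = monomial u - monomial v)"

definition binomial_of_degree ::
    "('m::finite \<Rightarrow> int ^ 'n) \<Rightarrow> int ^ 'n \<Rightarrow> ('m, 'k::field) mpoly \<Rightarrow> bool"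
  where "binomial_of_degree a b B \<longleftrightarrow>
    (\<exists>u v. u \<noteq> v \<and> B = monomial u - monomial v \<and> A_degree a u = b \<and> A_degree a v = b)"

definition binomial_degrees ::
    "('m::finite \<Rightarrow> int ^ 'n) \<Rightarrow> ('m, 'k::field) mpoly set \<Rightarrow> (int ^ 'n) set"
  where "binomial_degrees a I = {b. \<exists>B\<in>I. binomial_of_degree a b B}"

definition minimal_binomial_degree ::
    "('m::finite \<Rightarrow> int ^ 'n) \<Rightarrow> ('m, 'k::field) mpoly set \<Rightarrow> int ^ 'n \<Rightarrow> bool"
  where "minimal_binomial_degree a I b \<longleftrightarrow>
    b \<in> binomial_degrees a I \<and> (\<forall>c\<in>binomial_degrees a I. A_ge a b c \<longrightarrow> c = b)"

definition binomial_generating_set ::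
    "('m, 'k::field) mpoly set \<Rightarrow> ('m, 'k) mpoly set \<Rightarrow> bool"
  where "binomial_generating_set I S \<longleftrightarrow> (\<forall>B\<in>S. is_binomial B) \<and> ideal_generated S = I"

text \<open>Minimality is with respect to inclusion.\<close>

definition minimal_generating_set ::
    "('m, 'k::field) mpoly set \<Rightarrow> ('m, 'k) mpoly set \<Rightarrow> bool"
  where "minimal_generating_set I S \<longleftrightarrow>
    binomial_generating_set I S \<and> (\<forall>T. T \<subset> S \<longrightarrow> ideal_generated T \<noteq> I)"

definition indispensable :: "('m, 'k::field) mpoly set \<Rightarrow> ('m, 'k) mpoly \<Rightarrow> bool"
  where "indispensable I B \<longleftrightarrow>
    is_binomial B \<and> B \<in> I \<and> (\<forall>S. binomial_generating_set I S \<longrightarrow> B \<in> S \<or> - B \<in> S)"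

definition betti_degree ::
    "('m::finite \<Rightarrow> int ^ 'n) \<Rightarrow> ('m, 'k::field) mpoly set \<Rightarrow> int ^ 'n \<Rightarrow> bool"
  where "betti_degree a I b \<longleftrightarrow>
    (\<exists>S. minimal_generating_set I S \<and> (\<exists>B\<in>S. binomial_of_degree a b B))"

text \<open>
  The graded Betti number \<open>\<beta>\<^bsub>0,b\<^esub>\<close> as read off from a given minimal generating set \<open>S\<close>.
  It is independent of \<open>S\<close> when no vector of the configuration is zero; a zero vector
  \<open>a i = 0\<close> destroys independence, since \<open>x\<^sub>i - 1\<close> may be replaced by \<open>x\<^sub>i^2 - 1\<close> and
  \<open>x\<^sub>i^3 - 1\<close>.  Statements about \<open>\<beta>\<^bsub>0,b\<^esub>\<close> are therefore made for all minimal generating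
  sets.
\<close>

definition betti_number ::
    "('m::finite \<Rightarrow> int ^ 'n) \<Rightarrow> ('m, 'k::field) mpoly set \<Rightarrow> int ^ 'n \<Rightarrow> nat"
  where "betti_number a S b = card {B \<in> S. binomial_of_degree a b B}"

end

theory Submission
  imports Defs
begin

text \<open>
  Membership of \<open>x\<^sup>u - x\<^sup>v\<close> in a binomial ideal only depends on the congruence on exponents
  generated by the binomials: summing the coefficients over a congruence class is a linear
  functional that kills the ideal.  If \<open>b\<close> is a minimal binomial degree and no nonzero exponent
  has degree 0, then nothing of smaller degree contributes to the fibre of \<open>b\<close>, so \<open>\<beta>\<^bsub>0,b\<^esub> = 1\<close>
  says that this fibre has exactly two elements, whose difference is then indispensable.
  Conversely, \<open>x\<^sup>u - x\<^sup>v\<close> can be avoided as soon as \<open>u\<close> and \<open>v\<close> are linked through a third element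
  of the fibre, or are a translate of a pair of smaller degree.
\<close>

section \<open>Binomial ideals and congruences\<close>

global_interpretation ideal: module "(*) :: 'r::comm_ring_1 \<Rightarrow> 'r \<Rightarrow> 'r"
  by unfold_locales (simp_all add: algebra_simps)

lemma lookup_monomial: "Poly_Mapping.lookup (monomial u) k = (if u = k then 1 else 0)"
  by (simp add: lookup_single when_def)

lemma monomial_eq_iff: "(monomial u :: ('m, 'k::field) mpoly) = monomial v \<longleftrightarrow> u = v"
  by (metis lookup_monomial zero_neq_one)

lemma keys_binomial:
  assumes "u \<noteq> v"
  shows "Poly_Mapping.keys (monomial u - monomial v :: ('m, 'k::field) mpoly) = {u, v}"
  using assms by (auto simp: in_keys_iff lookup_minus lookup_monomial split: if_splits)

text \<open>In characteristic 2 a binomial equals its negative, so only the unordered pair of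
  exponents, read off as the support, can be recovered.\<close>

lemma binomial_eqD:
  assumes "u \<noteq> v" and eq: "(monomial u - monomial v :: ('m, 'k::field) mpoly) = monomial p - monomial q"
  shows "{u, v} = {p, q}"
proof -
  have "p \<noteq> q"
    using assms monomial_eq_iff[where 'k = 'k, of u v] by auto
  then show ?thesis
    using keys_binomial[OF \<open>u \<noteq> v\<close>, where 'k = 'k] keys_binomial[of p q, where 'k = 'k] eq by simp
qed

text \<open>Turns the overwriting step of \<open>update_induct\<close> into addition of one term,
  the form in which additive maps such as \<open>class_sum\<close> can be evaluated.\<close>

lemma poly_mapping_single_induct [case_names zero add]:
  fixes f :: "'a \<Rightarrow>\<^sub>0 'b::monoid_add"
  assumes "P 0" and step: "\<And>k c f. P f \<Longrightarrow> P (Poly_Mapping.single k c + f)"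
  shows "P f"
proof (induction f rule: update_induct)
  case const
  show ?case by fact
next
  case (update f a b)
  have "Poly_Mapping.update a b f = Poly_Mapping.single a b + f"
    by (rule poly_mapping_eqI)
       (use update(1) in \<open>auto simp: lookup_update lookup_add lookup_single when_def in_keys_iff\<close>)
  then show ?case
    using step[OF update(3)] by simp
qed

definition congruence :: "('a::monoid_add \<Rightarrow> 'a \<Rightarrow> bool) \<Rightarrow> bool"
  where "congruence R \<longleftrightarrow> equivp R \<and> (\<forall>w u v. R u v \<longrightarrow> R (w + u) (w + v))"

lemma congruenceI:
  assumes "\<And>u. R u u" "\<And>u v. R u v \<Longrightarrow> R v u" "\<And>u v w. R u v \<Longrightarrow> R v w \<Longrightarrow> R u w"
    "\<And>w u v. R u v \<Longrightarrow> R (w + u) (w + v)"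
  shows "congruence R"
  unfolding congruence_def using assms
  by (intro conjI equivpI reflpI sympI transpI) blast+

text \<open>If \<open>C\<close> is a class of a congruence, this is the coefficient at
  \<open>C\<close> of the image of \<open>f\<close> in the monoid algebra of the quotient
  monoid.\<close>

definition class_sum :: "('a \<Rightarrow> bool) \<Rightarrow> ('a \<Rightarrow>\<^sub>0 'b::comm_monoid_add) \<Rightarrow> 'b"
  where "class_sum C f = (\<Sum>k\<in>Poly_Mapping.keys f. if C k then Poly_Mapping.lookup f k else 0)"

lemma class_sum_superset:
  assumes "finite A" "Poly_Mapping.keys f \<subseteq> A"
  shows "class_sum C f = (\<Sum>k\<in>A. if C k then Poly_Mapping.lookup f k else 0)"
  unfolding class_sum_def
  by (rule sum.mono_neutral_left) (use assms in \<open>auto simp: in_keys_iff\<close>)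

lemma class_sum_add:
  fixes f g :: "'a \<Rightarrow>\<^sub>0 'b::comm_monoid_add"
  shows "class_sum C (f + g) = class_sum C f + class_sum C g"
proof -
  let ?A = "Poly_Mapping.keys f \<union> Poly_Mapping.keys g"
  let ?c = "\<lambda>h k. if C k then Poly_Mapping.lookup h k else 0"
  have *: "class_sum C h = sum (?c h) ?A" if "Poly_Mapping.keys h \<subseteq> ?A" for h :: "'a \<Rightarrow>\<^sub>0 'b"
    by (rule class_sum_superset) (use that in auto)
  have "class_sum C (f + g) = sum (?c (f + g)) ?A"
    by (rule *[OF keys_add])
  also have "\<dots> = (\<Sum>k\<in>?A. ?c f k + ?c g k)"
    by (rule sum.cong) (auto simp: lookup_add)
  also have "\<dots> = sum (?c f) ?A + sum (?c g) ?A"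
    by (rule sum.distrib)
  also have "\<dots> = class_sum C f + class_sum C g"
    by (simp only: *[OF Un_upper1] *[OF Un_upper2])
  finally show ?thesis .
qed

lemma class_sum_zero [simp]: "class_sum C 0 = 0"
  by (simp add: class_sum_def)

lemma class_sum_single: "class_sum C (Poly_Mapping.single k c) = (if C k then c else 0)"
  by (subst class_sum_superset[of "{k}"]) auto

lemma class_sum_diff:
  fixes f g :: "'a \<Rightarrow>\<^sub>0 'b::ab_group_add"
  shows "class_sum C (f - g) = class_sum C f - class_sum C g"
  using class_sum_add[of C "f - g" g] by (simp add: algebra_simps)

text \<open>Multiplying a generator by a term moves both exponents into one class, so
  \<open>class_sum (R x)\<close> kills the whole ideal; on \<open>monomial x - monomial y\<close>
  its value would be 1 if \<open>y\<close> were not related to \<open>x\<close>. Later proofs use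
  this to keep binomials out of an ideal.\<close>

lemma span_binomials_congruence:
  fixes S :: "('m, 'k::field) mpoly set"
  assumes R: "congruence R"
    and S: "\<And>B. B \<in> S \<Longrightarrow> \<exists>u v. R u v \<and> B = monomial u - monomial v"
    and xy: "monomial x - monomial y \<in> ideal_generated S"
  shows "R x y"
proof -
  have equiv: "equivp R" and trans: "\<And>w u v. R u v \<Longrightarrow> R (w + u) (w + v)"
    using R by (auto simp: congruence_def)
  have mult: "class_sum (R x) (c * B) = 0" if "B \<in> S" for c B
  proof -
    obtain u v where uv: "R u v" and B: "B = monomial u - monomial v"
      using S \<open>B \<in> S\<close> by blast
    show ?thesis
    proof (induction c rule: poly_mapping_single_induct)
      case (add w t c)
      have "R x (w + u) \<longleftrightarrow> R x (w + v)"
        using trans[OF uv] equiv by (meson equivp_symp equivp_transp)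
      then show ?case
        using add by (simp add: B ring_distribs mult_single class_sum_add class_sum_diff class_sum_single)
    qed simp
  qed
  have "class_sum (R x) f = 0" if "f \<in> ideal_generated S" for f
    using that by (induction rule: ideal.span_induct_alt) (simp_all add: class_sum_add mult)
  from this[OF xy] show ?thesis
    using equivp_reflp[OF equiv, of x] by (auto simp: class_sum_diff class_sum_single split: if_splits)
qed

lemma span_binomial_sym:
  "monomial u - monomial v \<in> ideal_generated S \<Longrightarrow> monomial v - monomial u \<in> ideal_generated S"
  using ideal.span_neg by force

lemma span_binomial_trans:
  assumes "monomial u - monomial v \<in> ideal_generated S" "monomial v - monomial w \<in> ideal_generated S"
  shows "monomial u - monomial w \<in> ideal_generated S"
  using ideal.span_add[OF assms] by simp

lemma span_binomial_translate:
  assumes "monomial u - monomial v \<in> ideal_generated S"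
  shows "monomial (w + u) - monomial (w + v) \<in> ideal_generated S"
  using ideal.span_scale[OF assms, of "monomial w"] by (simp add: algebra_simps mult_single)

section \<open>The toric ideal\<close>

lemma A_degree_zero [simp]: "A_degree a 0 = 0"
  by (simp add: A_degree_def)

lemma A_degree_add [simp]: "A_degree a (u + v) = A_degree a u + A_degree a v"
  by (simp add: A_degree_def vec_eq_iff lookup_add sum.distrib algebra_simps)

lemma A_degree_single: "A_degree a (Poly_Mapping.single i n) = int n *s a i"
proof -
  have "(\<Sum>j\<in>UNIV. int (Poly_Mapping.lookup (Poly_Mapping.single i n) j) *s a j)
      = (\<Sum>j\<in>UNIV. if j = i then int n *s a i else 0)"
    by (rule sum.cong) (auto simp: lookup_single when_def)
  then show ?thesis
    by (simp add: A_degree_def)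
qed

lemma NA_eq_range: "NA a = range (A_degree a)"
proof (intro equalityI subsetI)
  fix c assume "c \<in> NA a"
  then obtain l where "c = (\<Sum>i\<in>UNIV. int (l i) *s a i)"
    by (auto simp: NA_def)
  moreover have "Poly_Mapping.lookup (Abs_poly_mapping l) = l"
    by (simp add: lookup_Abs_poly_mapping)
  ultimately have "c = A_degree a (Abs_poly_mapping l)"
    by (simp add: A_degree_def)
  then show "c \<in> range (A_degree a)" by blast
qed (auto simp: NA_def A_degree_def)

text \<open>Splitting one variable off a nonzero \<open>w\<close> of degree zero exhibits some
  \<open>a i\<close> as an invertible element of \<open>NA a\<close>; pointedness then makes it
  zero.\<close>

lemma A_degree_eq_zeroD:
  fixes a :: "'m::finite \<Rightarrow> int ^ 'n"
  assumes pointed: "pointed (NA a)" and nz: "\<And>i. a i \<noteq> 0" and w: "A_degree a w = 0"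
  shows "w = 0"
proof (rule ccontr)
  assume "w \<noteq> 0"
  then obtain i where i: "Poly_Mapping.lookup w i \<noteq> 0"
    by (metis poly_mapping_eqI lookup_zero)
  let ?s = "Poly_Mapping.single i 1 :: 'm \<Rightarrow>\<^sub>0 nat"
  have "w = ?s + (w - ?s)"
    by (rule poly_mapping_eqI) (use i in \<open>auto simp: lookup_add lookup_minus lookup_single when_def\<close>)
  then have "A_degree a ?s + A_degree a (w - ?s) = 0"
    using w by (metis A_degree_add)
  then have "- A_degree a ?s = A_degree a (w - ?s)"
    by (metis add_eq_0_iff)
  then have "A_degree a ?s = 0"
    using pointed unfolding pointed_def NA_eq_range by (metis rangeI)
  then show False
    using nz[of i] by (simp add: A_degree_single)
qed

lemma congruence_A_degree: "congruence (\<lambda>u v. A_degree a u = A_degree a v)"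
  by (rule congruenceI) auto

lemma binomial_in_toric_ideal:
  "(monomial u - monomial v :: ('m::finite, 'k::field) mpoly) \<in> toric_ideal a
    \<longleftrightarrow> A_degree a u = A_degree a v"
proof
  assume "(monomial u - monomial v :: ('m, 'k) mpoly) \<in> toric_ideal a"
  then show "A_degree a u = A_degree a v"
    unfolding toric_ideal_def by (rule span_binomials_congruence[OF congruence_A_degree, rotated]) auto
next
  assume "A_degree a u = A_degree a v"
  then show "(monomial u - monomial v :: ('m, 'k) mpoly) \<in> toric_ideal a"
    unfolding toric_ideal_def by (blast intro: ideal.span_base)
qed

lemma span_subset_toric_ideal:
  "S \<subseteq> toric_ideal a \<Longrightarrow> ideal_generated S \<subseteq> toric_ideal a"
  unfolding toric_ideal_def by (simp add: ideal.span_minimal)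

lemma span_eq_toric_idealI:
  fixes S :: "('m::finite, 'k::field) mpoly set"
  assumes "S \<subseteq> toric_ideal a"
    and "\<And>u v. u \<noteq> v \<Longrightarrow> A_degree a u = A_degree a v \<Longrightarrow> monomial u - monomial v \<in> ideal_generated S"
  shows "ideal_generated S = toric_ideal a"
proof (rule subset_antisym[OF span_subset_toric_ideal[OF assms(1)]])
  have "monomial u - monomial v \<in> ideal_generated S" if "A_degree a u = A_degree a v" for u v
    using assms(2)[OF _ that] by (cases "u = v") (simp_all add: ideal.span_zero)
  then show "toric_ideal a \<subseteq> ideal_generated S"
    unfolding toric_ideal_def by (intro ideal.span_minimal) auto
qed

lemma binomial_generating_setD:
  fixes S :: "('m::finite, 'k::field) mpoly set"
  assumes "binomial_generating_set (toric_ideal a) S" "B \<in> S"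
  obtains u v where "u \<noteq> v" "B = monomial u - monomial v" "A_degree a u = A_degree a v"
proof -
  obtain u v where "u \<noteq> v" "B = monomial u - monomial v"
    using assms by (auto simp: binomial_generating_set_def is_binomial_def)
  moreover have "B \<in> toric_ideal a"
    using assms ideal.span_base by (auto simp: binomial_generating_set_def)
  ultimately show ?thesis
    using that by (metis binomial_in_toric_ideal)
qed

lemma binomial_generating_set_all:
  "binomial_generating_set (toric_ideal a)
    {monomial u - monomial v :: ('m::finite, 'k::field) mpoly |u v. u \<noteq> v \<and> A_degree a u = A_degree a v}"
  (is "binomial_generating_set _ ?S")
  unfolding binomial_generating_set_def
proof
  show "ideal_generated ?S = toric_ideal a"
    by (rule span_eq_toric_idealI) (auto simp: binomial_in_toric_ideal intro!: ideal.span_base)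
qed (auto simp: is_binomial_def)

section \<open>Existence of minimal generating sets\<close>

lemma nat_seq_mono_subseq:
  fixes s :: "nat \<Rightarrow> nat"
  obtains r :: "nat \<Rightarrow> nat" where "strict_mono r" "mono (\<lambda>n. s (r n))"
proof -
  obtain f where f: "strict_mono f" "monoseq (\<lambda>n. s (f n))"
    using seq_monosub by blast
  show ?thesis
  proof (cases "mono (\<lambda>n. s (f n))")
    case True
    then show ?thesis using that f by blast
  next
    case False
    then have dec: "s (f n) \<le> s (f m)" if "m \<le> n" for m n
      using f(2) that by (auto simp: monoseq_def mono_def)
    \<comment> \<open>A decreasing sequence of naturals is constant from the index \<open>N\<close>
      of its least value on, so its tail is monotone.\<close>
    obtain N where N: "\<And>n. s (f N) \<le> s (f n)"
      using ex_has_least_nat[of "\<lambda>_. True" _ "\<lambda>n. s (f n)"] by blast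
    have "s (f (N + n)) = s (f N)" for n
      using dec[of N "N + n"] N[of "N + n"] by simp
    then have "mono (\<lambda>n. s (f (N + n)))"
      by (simp add: mono_def)
    moreover have "strict_mono (\<lambda>n. f (N + n))"
      using f(1) by (simp add: strict_mono_def)
    ultimately show ?thesis using that by blast
  qed
qed

lemma dickson_subseq:
  fixes f :: "nat \<Rightarrow> 'i \<Rightarrow> nat"
  assumes "finite A"
  shows "\<exists>r :: nat \<Rightarrow> nat. strict_mono r \<and> (\<forall>i\<in>A. mono (\<lambda>n. f (r n) i))"
  using assms
proof (induction A)
  case empty
  show ?case by (intro exI[of _ id]) (simp add: strict_mono_def)
next
  case (insert i A)
  then obtain r :: "nat \<Rightarrow> nat" where r: "strict_mono r" "\<And>j. j \<in> A \<Longrightarrow> mono (\<lambda>n. f (r n) j)"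
    by blast
  obtain s :: "nat \<Rightarrow> nat" where s: "strict_mono s" "mono (\<lambda>n. f (r (s n)) i)"
    by (rule nat_seq_mono_subseq[of "\<lambda>n. f (r n) i"])
  have "mono (\<lambda>n. f (r (s n)) j)" if "j \<in> insert i A" for j
    using that r(2)[of j] s(2) strict_mono_mono[OF s(1)] by (auto simp: mono_def)
  moreover have "strict_mono (\<lambda>n. r (s n))"
    using r(1) s(1) by (simp add: strict_mono_def)
  ultimately show ?case
    by (intro exI[of _ "\<lambda>n. r (s n)"]) simp
qed

text \<open>\<open>Y\<close> consists of the minimal elements of \<open>X\<close>. A sequence of
  distinct ones would have a coordinatewise monotone subsequence, hence two comparable members;
  descent on the coordinate sum finds one below each \<open>x\<close>.\<close>

lemma dickson:
  fixes X :: "('i::finite \<Rightarrow> nat) set"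
  obtains Y where "finite Y" "Y \<subseteq> X" "\<And>x. x \<in> X \<Longrightarrow> \<exists>y\<in>Y. y \<le> x"
proof -
  let ?Y = "{x \<in> X. \<forall>y\<in>X. y \<le> x \<longrightarrow> y = x}"
  have "finite ?Y"
  proof (rule ccontr)
    assume "infinite ?Y"
    then obtain f :: "nat \<Rightarrow> 'i \<Rightarrow> nat" where f: "inj f" "range f \<subseteq> ?Y"
      using infinite_countable_subset by blast
    obtain r :: "nat \<Rightarrow> nat" where r: "strict_mono r" "\<And>i. mono (\<lambda>n. f (r n) i)"
      using dickson_subseq[of UNIV f] by auto
    have "f (r 0) \<le> f (r 1)"
      using r(2) by (simp add: le_fun_def mono_def)
    moreover have "f (r 0) \<in> ?Y" "f (r 1) \<in> ?Y"
      using f(2) by blast+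
    ultimately have "r 0 = r 1"
      using f(1) by (auto dest: injD)
    then show False
      using strict_monoD[OF r(1), of 0 1] by simp
  qed
  moreover have "\<exists>y\<in>?Y. y \<le> x" if "x \<in> X" for x
    using that
  proof (induction "\<Sum>i\<in>UNIV. x i" arbitrary: x rule: less_induct)
    case less
    show ?case
    proof (cases "x \<in> ?Y")
      case False
      then obtain y where y: "y \<in> X" "y \<le> x" "y \<noteq> x"
        using less.prems by blast
      have "(\<Sum>i\<in>UNIV. y i) < (\<Sum>i\<in>UNIV. x i)"
      proof (rule sum_strict_mono_ex1)
        show "\<exists>i\<in>UNIV. y i < x i"
          using y(2,3) by (metis UNIV_I ext le_fun_def le_neq_implies_less)
      qed (use y(2) in \<open>auto simp: le_fun_def\<close>)
      then show ?thesis
        using less.hyps[OF _ y(1)] y(2) by (meson order_trans)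
    qed auto
  qed
  ultimately show ?thesis
    using that[of ?Y] by blast
qed

text \<open>Pairs of exponents are vectors in twice as many variables, so by Dickson's lemma each
  pair \<open>(u, v)\<close> in \<open>X\<close> lies above some \<open>(p, q)\<close> from a finite
  subset. Then x^u - x^v = x^(u-p) (x^p - x^q) + x^q (x^(u-p) - x^(v-q)), where the last factor
  again has equal degrees.\<close>

lemma toric_ideal_finitely_generated:
  fixes a :: "'m::finite \<Rightarrow> int ^ 'n"
  obtains G :: "('m, 'k::field) mpoly set" where "finite G" "ideal_generated G = toric_ideal a"
proof -
  \<comment> \<open>Equal pairs are left out, since \<open>(0, 0)\<close> would lie below every pair
    and nothing could be subtracted.\<close>
  define X where "X = {(u, v). u \<noteq> v \<and> A_degree a u = A_degree a v}"
  define h :: "('m \<Rightarrow>\<^sub>0 nat) \<times> ('m \<Rightarrow>\<^sub>0 nat) \<Rightarrow> 'm + 'm \<Rightarrow> nat"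
    where "h = (\<lambda>(u, v). case_sum (Poly_Mapping.lookup u) (Poly_Mapping.lookup v))"
  have h_le: "Poly_Mapping.lookup p i \<le> Poly_Mapping.lookup u i"
    "Poly_Mapping.lookup q i \<le> Poly_Mapping.lookup v i"
    if "h (p, q) \<le> h (u, v)" for p q u v i
    using le_funD[OF that, of "Inl i"] le_funD[OF that, of "Inr i"] by (simp_all add: h_def)
  obtain Y where Y: "finite Y" "Y \<subseteq> h ` X" "\<And>x. x \<in> h ` X \<Longrightarrow> \<exists>y\<in>Y. y \<le> x"
    using dickson by blast
  obtain Z where Z: "Z \<subseteq> X" "finite Z" "Y = h ` Z"
    using finite_subset_image[OF Y(1,2)] by blast
  define G :: "('m, 'k) mpoly set" where "G = (\<lambda>(u, v). monomial u - monomial v) ` Z"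
  have "monomial u - monomial v \<in> ideal_generated G" if "A_degree a u = A_degree a v" for u v
    using that
  proof (induction "\<Sum>i\<in>UNIV. Poly_Mapping.lookup u i + Poly_Mapping.lookup v i"
      arbitrary: u v rule: less_induct)
    case less
    show ?case
    proof (cases "u = v")
      case True
      then show ?thesis by (simp add: ideal.span_zero)
    next
      case False
      then have "h (u, v) \<in> h ` X"
        using less.prems by (auto simp: X_def)
      then obtain z where z: "z \<in> Z" "h z \<le> h (u, v)"
        using Y(3) unfolding Z(3) by blast
      obtain p q where "z = (p, q)"
        by (rule prod.exhaust)
      with z have pq: "(p, q) \<in> Z" "h (p, q) \<le> h (u, v)"
        by simp_all
      have le: "Poly_Mapping.lookup p i \<le> Poly_Mapping.lookup u i"
        "Poly_Mapping.lookup q i \<le> Poly_Mapping.lookup v i" for i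
        using h_le[OF pq(2)] by blast+
      have u: "(u - p) + p = u" and v: "(v - q) + q = v"
        by (rule poly_mapping_eqI, simp add: lookup_add lookup_minus le)+
      have "p \<noteq> q" and deg: "A_degree a p = A_degree a q"
        using pq(1) Z(1) by (auto simp: X_def)
      then obtain j where "Poly_Mapping.lookup p j \<noteq> Poly_Mapping.lookup q j"
        by (metis poly_mapping_eqI)
      \<comment> \<open>One of \<open>p\<close>, \<open>q\<close> is nonzero at \<open>j\<close>, so
        subtracting them strictly lowers the total of the exponents.\<close>
      then have j: "Poly_Mapping.lookup p j > 0 \<or> Poly_Mapping.lookup q j > 0"
        by linarith
      have "(\<Sum>i\<in>UNIV. Poly_Mapping.lookup (u - p) i + Poly_Mapping.lookup (v - q) i)
          < (\<Sum>i\<in>UNIV. Poly_Mapping.lookup u i + Poly_Mapping.lookup v i)"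
      proof (rule sum_strict_mono_ex1)
        show "\<exists>i\<in>UNIV. Poly_Mapping.lookup (u - p) i + Poly_Mapping.lookup (v - q) i
            < Poly_Mapping.lookup u i + Poly_Mapping.lookup v i"
          using j le[of j] by (intro bexI[of _ j]) (auto simp: lookup_minus)
      qed (auto simp: lookup_minus)
      moreover have "A_degree a (u - p) = A_degree a (v - q)"
        using less.prems deg A_degree_add[of a "u - p" p] A_degree_add[of a "v - q" q]
        unfolding u v by simp
      ultimately have "monomial (u - p) - monomial (v - q) \<in> ideal_generated G"
        by (rule less.hyps)
      then have "monomial (q + (u - p)) - monomial (q + (v - q)) \<in> ideal_generated G"
        by (rule span_binomial_translate)
      then have "monomial ((u - p) + q) - monomial v \<in> ideal_generated G"
        by (simp only: add.commute[of q] v)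
      moreover have "monomial p - monomial q \<in> G"
        unfolding G_def by (rule image_eqI[OF _ pq(1)]) simp
      then have "monomial ((u - p) + p) - monomial ((u - p) + q) \<in> ideal_generated G"
        by (intro span_binomial_translate ideal.span_base)
      then have "monomial u - monomial ((u - p) + q) \<in> ideal_generated G"
        by (simp only: u)
      ultimately show ?thesis
        using span_binomial_trans by blast
    qed
  qed
  moreover have "G \<subseteq> toric_ideal a"
    using Z(1) by (auto simp: G_def X_def binomial_in_toric_ideal)
  ultimately have "ideal_generated G = toric_ideal a"
    by (intro span_eq_toric_idealI)
  moreover have "finite G"
    using Z(2) by (simp add: G_def)
  ultimately show ?thesis
    using that by blast
qed

lemma span_finite_subset:
  fixes S :: "'r::comm_ring_1 set"
  assumes "finite G" "G \<subseteq> ideal_generated S"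
  shows "\<exists>T. finite T \<and> T \<subseteq> S \<and> G \<subseteq> ideal_generated T"
  using assms
proof (induction G)
  case (insert g G)
  then obtain T where T: "finite T" "T \<subseteq> S" "G \<subseteq> ideal_generated T"
    by auto
  obtain U r where U: "finite U" "U \<subseteq> S" "g = (\<Sum>u\<in>U. r u * u)"
    using insert.prems unfolding ideal.span_explicit by blast
  then have "g \<in> ideal_generated U"
    by (auto intro: ideal.span_sum ideal.span_scale ideal.span_base)
  then have "insert g G \<subseteq> ideal_generated (T \<union> U)"
    using T(3) ideal.span_mono[of T "T \<union> U"] ideal.span_mono[of U "T \<union> U"] by auto
  then show ?case
    using T U by (intro exI[of _ "T \<union> U"]) auto
qed auto

text \<open>Finite generation cuts \<open>S\<close> down to a finite generating \<open>T\<close>.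
  Among the finitely many generating subsets of \<open>T\<close>, an inclusion-minimal one is
  minimal outright, since all its subsets lie in \<open>T\<close>.\<close>

lemma minimal_generating_set_exists:
  fixes S :: "('m::finite, 'k::field) mpoly set"
  assumes S: "binomial_generating_set (toric_ideal a) S"
  obtains U where "finite U" "U \<subseteq> S" "minimal_generating_set (toric_ideal a) U"
proof -
  obtain G :: "('m, 'k) mpoly set" where G: "finite G" "ideal_generated G = toric_ideal a"
    using toric_ideal_finitely_generated by blast
  have span_S: "ideal_generated S = toric_ideal a"
    using S by (simp add: binomial_generating_set_def)
  then have sub: "G \<subseteq> ideal_generated S"
    using ideal.span_superset[of G] G(2) by simp
  then obtain T where T: "finite T" "T \<subseteq> S" "G \<subseteq> ideal_generated T"
    using span_finite_subset[OF G(1) sub] by auto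
  have "ideal_generated T = toric_ideal a"
    using ideal.span_mono[OF T(2)] ideal.span_minimal[OF T(3) ideal.subspace_span] G(2) span_S by auto
  then have "{U. U \<subseteq> T \<and> ideal_generated U = toric_ideal a} \<noteq> {}" (is "?M \<noteq> {}")
    by auto
  moreover have "finite ?M"
    using T(1) by simp
  ultimately have "\<exists>U\<in>?M. \<forall>V\<in>?M. V \<subseteq> U \<longrightarrow> U = V"
    by (intro finite_has_minimal)
  then obtain U where U: "U \<subseteq> T" "ideal_generated U = toric_ideal a"
    "\<And>V. V \<subseteq> T \<Longrightarrow> ideal_generated V = toric_ideal a \<Longrightarrow> V \<subseteq> U \<Longrightarrow> U = V"
    by auto
  have "minimal_generating_set (toric_ideal a) U"
    unfolding minimal_generating_set_def binomial_generating_set_def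
  proof (intro conjI allI impI ballI notI)
    show "is_binomial B" if "B \<in> U" for B
      using that U(1) T(2) S unfolding binomial_generating_set_def by blast
    show "ideal_generated U = toric_ideal a"
      by (rule U(2))
    show False if "V \<subset> U" "ideal_generated V = toric_ideal a" for V
      using that U(1) U(3)[of V] by blast
  qed
  then show ?thesis
    using that[of U] finite_subset[OF U(1) T(1)] U(1) T(2) by blast
qed

section \<open>Indispensable binomials\<close>

lemma is_binomial_uminus: "is_binomial (- B) \<longleftrightarrow> is_binomial B"
  unfolding is_binomial_def by (metis minus_diff_eq minus_minus)

lemma indispensable_uminus:
  assumes "indispensable (toric_ideal a) B"
  shows "indispensable (toric_ideal a) (- B)"
  using assms unfolding indispensable_def toric_ideal_def
  by (auto simp: is_binomial_uminus intro: ideal.span_neg)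

text \<open>Otherwise the binomials of the toric ideal other than the given one and its negative
  would form a binomial generating set avoiding both. This is the working form of indispensability
  below.\<close>

lemma indispensable_notin_span_others:
  fixes a :: "'m::finite \<Rightarrow> int ^ 'n"
  assumes ind: "indispensable (toric_ideal a) (monomial u - monomial v :: ('m, 'k::field) mpoly)"
    and "u \<noteq> v"
  shows "(monomial u - monomial v :: ('m, 'k) mpoly) \<notin> ideal_generated
    {monomial p - monomial q |p q. p \<noteq> q \<and> A_degree a p = A_degree a q \<and> {p, q} \<noteq> {u, v}}"
    (is "_ \<notin> ideal_generated ?N")
proof
  assume *: "(monomial u - monomial v :: ('m, 'k) mpoly) \<in> ideal_generated ?N"
  have "monomial p - monomial q \<in> ideal_generated ?N"
    if "p \<noteq> q" "A_degree a p = A_degree a q" for p q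
  proof (cases "{p, q} = {u, v}")
    case True
    then show ?thesis
      using * span_binomial_sym[OF *] by (auto simp: doubleton_eq_iff)
  qed (use that in \<open>blast intro: ideal.span_base\<close>)
  then have "ideal_generated ?N = toric_ideal a"
    by (intro span_eq_toric_idealI) (auto simp: binomial_in_toric_ideal)
  moreover have "\<forall>B\<in>?N. is_binomial B"
    by (auto simp: is_binomial_def)
  ultimately have "monomial u - monomial v \<in> ?N \<or> - (monomial u - monomial v) \<in> ?N"
    using ind unfolding indispensable_def binomial_generating_set_def by blast
  then obtain p q where pq: "{p, q} \<noteq> {u, v}"
    and "(monomial u - monomial v :: ('m, 'k) mpoly) = monomial p - monomial q
      \<or> (monomial v - monomial u :: ('m, 'k) mpoly) = monomial p - monomial q"
    by auto
  then show False
    using binomial_eqD[of u v p q, where 'k = 'k] binomial_eqD[of v u p q, where 'k = 'k] \<open>u \<noteq> v\<close>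
    by (auto simp: insert_commute)
qed

text \<open>A third exponent \<open>w\<close> of the fibre would give (x^u - x^w) + (x^w - x^v), a
  sum of two other binomials.\<close>

lemma indispensable_fibre:
  fixes a :: "'m::finite \<Rightarrow> int ^ 'n"
  assumes ind: "indispensable (toric_ideal a) (monomial u - monomial v :: ('m, 'k::field) mpoly)"
    and "u \<noteq> v" and deg: "A_degree a u = A_degree a v" "A_degree a w = A_degree a v"
  shows "w \<in> {u, v}"
proof (rule ccontr)
  assume w: "w \<notin> {u, v}"
  let ?N = "{monomial p - monomial q :: ('m, 'k) mpoly |p q.
    p \<noteq> q \<and> A_degree a p = A_degree a q \<and> {p, q} \<noteq> {u, v}}"
  have "monomial u - monomial w \<in> ideal_generated ?N" "monomial w - monomial v \<in> ideal_generated ?N"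
    using w deg by (intro ideal.span_base; force)+
  then have "monomial u - monomial v \<in> ideal_generated ?N"
    by (rule span_binomial_trans)
  then show False
    using indispensable_notin_span_others[OF ind \<open>u \<noteq> v\<close>] by blast
qed

text \<open>A binomial of strictly smaller degree, multiplied by \<open>monomial w\<close>, lands in
  the fibre, which is just \<open>{u, v}\<close>. It would thus produce the indispensable binomial,
  up to sign, from a different one.\<close>

lemma indispensable_minimal_degree:
  fixes a :: "'m::finite \<Rightarrow> int ^ 'n"
  assumes ind: "indispensable (toric_ideal a) (monomial u - monomial v :: ('m, 'k::field) mpoly)"
    and "u \<noteq> v" and deg: "A_degree a u = A_degree a v"
    and pq: "p \<noteq> q" "A_degree a p = A_degree a q" and ge: "A_ge a (A_degree a u) (A_degree a p)"
  shows "A_degree a p = A_degree a u"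
proof (rule ccontr)
  assume neq: "A_degree a p \<noteq> A_degree a u"
  let ?N = "{monomial p - monomial q :: ('m, 'k) mpoly |p q.
    p \<noteq> q \<and> A_degree a p = A_degree a q \<and> {p, q} \<noteq> {u, v}}"
  obtain w where w: "A_degree a u = A_degree a (w + p)"
    using ge unfolding A_ge_def NA_eq_range by (auto simp: add.commute)
  have "w + p \<in> {u, v}" "w + q \<in> {u, v}"
    using indispensable_fibre[OF ind \<open>u \<noteq> v\<close> deg] w deg pq(2) by auto
  moreover have "w + p \<noteq> w + q"
    using pq(1) by simp
  moreover have "monomial p - monomial q \<in> ideal_generated ?N"
    using pq neq deg by (intro ideal.span_base) (force simp: doubleton_eq_iff)
  then have "monomial (w + p) - monomial (w + q) \<in> ideal_generated ?N"
    by (rule span_binomial_translate)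
  ultimately have "monomial u - monomial v \<in> ideal_generated ?N"
    using span_binomial_sym by fastforce
  then show False
    using indispensable_notin_span_others[OF ind \<open>u \<noteq> v\<close>] by blast
qed

section \<open>From generation by indispensable binomials to the conditions on Betti degrees\<close>

lemma minimal_generating_set_indispensable:
  fixes S :: "('m::finite, 'k::field) mpoly set"
  assumes gen: "ideal_generated {B. indispensable (toric_ideal a) B} = (toric_ideal a :: ('m, 'k) mpoly set)"
    and S: "minimal_generating_set (toric_ideal a) S" and "B \<in> S"
  shows "indispensable (toric_ideal a) B"
proof -
  let ?Ind = "{B. indispensable (toric_ideal a) B}"
  \<comment> \<open>By indispensability \<open>S\<close> contains \<open>C\<close> or
    \<open>- C\<close>, so the indispensable members of \<open>S\<close> already generate the ideal;
    minimality of \<open>S\<close> leaves no room for others.\<close>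
  have *: "C \<in> ideal_generated (S \<inter> ?Ind)" if "C \<in> ?Ind" for C
  proof -
    have "C \<in> S \<inter> ?Ind \<or> - C \<in> S \<inter> ?Ind"
      using that S indispensable_uminus[of a C]
      by (auto simp: indispensable_def minimal_generating_set_def)
    then show ?thesis
      using ideal.span_base ideal.span_neg by (metis minus_minus)
  qed
  have "ideal_generated ?Ind \<subseteq> ideal_generated (S \<inter> ?Ind)"
    by (rule ideal.span_minimal) (use * in auto)
  then have "toric_ideal a \<subseteq> ideal_generated (S \<inter> ?Ind)"
    by (simp only: gen)
  moreover have "ideal_generated (S \<inter> ?Ind) \<subseteq> toric_ideal a"
    using S ideal.span_mono[of "S \<inter> ?Ind" S]
    by (auto simp: minimal_generating_set_def binomial_generating_set_def)
  ultimately have "ideal_generated (S \<inter> ?Ind) = toric_ideal a"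
    by (rule subset_antisym[rotated])
  then have "\<not> S \<inter> ?Ind \<subset> S"
    using S by (auto simp: minimal_generating_set_def)
  then have "S \<inter> ?Ind = S"
    by auto
  then show ?thesis
    using \<open>B \<in> S\<close> by blast
qed

text \<open>A member of degree \<open>b\<close> of some minimal generating set is indispensable, so
  \<open>S\<close> contains it up to sign. Its fibre is a pair, so a second member of degree
  \<open>b\<close> could only be its negative, which would be redundant.\<close>

lemma betti_number_eq_1_if_generated_by_indispensables:
  fixes a :: "'m::finite \<Rightarrow> int ^ 'n" and S :: "('m, 'k::field) mpoly set"
  assumes gen: "ideal_generated {B. indispensable (toric_ideal a) B} = (toric_ideal a :: ('m, 'k) mpoly set)"
    and betti: "betti_degree a (toric_ideal a :: ('m, 'k) mpoly set) b"
    and S: "minimal_generating_set (toric_ideal a) S"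
  shows "betti_number a S b = 1"
proof -
  obtain S0 B0 where S0: "minimal_generating_set (toric_ideal a) S0" "B0 \<in> S0"
    and B0: "binomial_of_degree a b (B0 :: ('m, 'k) mpoly)"
    using betti unfolding betti_degree_def by blast
  have "indispensable (toric_ideal a) B0"
    using minimal_generating_set_indispensable[OF gen S0] .
  then have "B0 \<in> S \<or> - B0 \<in> S"
    using S by (auto simp: indispensable_def minimal_generating_set_def)
  moreover have "binomial_of_degree a b (- B0)"
    using B0 unfolding binomial_of_degree_def by (metis minus_diff_eq)
  ultimately obtain B where B: "B \<in> S" "binomial_of_degree a b B"
    using B0 by blast
  then obtain u v where uv: "u \<noteq> v" "B = monomial u - monomial v" "A_degree a u = b" "A_degree a v = b"
    unfolding binomial_of_degree_def by blast
  have ind: "indispensable (toric_ideal a) B"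
    using minimal_generating_set_indispensable[OF gen S B(1)] .
  have "C = B" if C: "C \<in> S" "binomial_of_degree a b C" for C
  proof (rule ccontr)
    assume "C \<noteq> B"
    obtain p q where pq: "p \<noteq> q" "C = monomial p - monomial q" "A_degree a p = b" "A_degree a q = b"
      using C unfolding binomial_of_degree_def by blast
    have "p \<in> {u, v}" "q \<in> {u, v}"
      using indispensable_fibre[OF ind[unfolded uv(2)] uv(1)] uv pq by auto
    then have "C = - B"
      using pq uv \<open>C \<noteq> B\<close> by auto
    have "C \<in> S - {B}"
      using C \<open>C \<noteq> B\<close> by blast
    then have "B \<in> ideal_generated (S - {B})"
      using \<open>C = - B\<close> ideal.span_base ideal.span_neg by (metis minus_minus)
    then have "S \<subseteq> ideal_generated (S - {B})"
      using ideal.span_superset[of "S - {B}"] by auto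
    then have "ideal_generated (S - {B}) = ideal_generated S"
      by (simp add: ideal.span_minimal ideal.span_mono subset_antisym)
    then show False
      using S B(1) unfolding minimal_generating_set_def binomial_generating_set_def by blast
  qed
  then have "{B \<in> S. binomial_of_degree a b B} = {B}"
    using B by blast
  then show ?thesis
    by (simp add: betti_number_def)
qed

lemma betti_degree_minimal_if_generated_by_indispensables:
  fixes a :: "'m::finite \<Rightarrow> int ^ 'n"
  assumes gen: "ideal_generated {B. indispensable (toric_ideal a) B} = (toric_ideal a :: ('m, 'k::field) mpoly set)"
    and betti: "betti_degree a (toric_ideal a :: ('m, 'k) mpoly set) b"
  shows "minimal_binomial_degree a (toric_ideal a :: ('m, 'k) mpoly set) b"
proof -
  obtain S B where S: "minimal_generating_set (toric_ideal a) S" "B \<in> S"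
    and B: "binomial_of_degree a b (B :: ('m, 'k) mpoly)"
    using betti unfolding betti_degree_def by blast
  obtain u v where uv: "u \<noteq> v" "B = monomial u - monomial v" "A_degree a u = b" "A_degree a v = b"
    using B unfolding binomial_of_degree_def by blast
  have ind: "indispensable (toric_ideal a) B"
    using minimal_generating_set_indispensable[OF gen S] .
  then have "b \<in> binomial_degrees a (toric_ideal a :: ('m, 'k) mpoly set)"
    using B by (auto simp: indispensable_def binomial_degrees_def)
  moreover have "c = b"
    if "c \<in> binomial_degrees a (toric_ideal a :: ('m, 'k) mpoly set)" "A_ge a b c" for c
  proof -
    obtain p q where "p \<noteq> q" "A_degree a p = c" "A_degree a q = c"
      using \<open>c \<in> _\<close> unfolding binomial_degrees_def binomial_of_degree_def by blast
    then show ?thesis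
      using indispensable_minimal_degree[OF ind[unfolded uv(2)] uv(1), of p q] uv \<open>A_ge a b c\<close> by simp
  qed
  ultimately show ?thesis
    unfolding minimal_binomial_degree_def by blast
qed

section \<open>Fibres of minimal binomial degrees\<close>

text \<open>Minimality of \<open>b\<close> forces \<open>p\<close> to have degree \<open>b\<close>
  already, so \<open>w\<close> has degree zero. Thus no proper monomial multiple of a toric binomial
  reaches the fibre of \<open>b\<close>.\<close>

lemma minimal_binomial_degreeD:
  fixes a :: "'m::finite \<Rightarrow> int ^ 'n"
  assumes pointed: "pointed (NA a)" and nz: "\<And>i. a i \<noteq> 0"
    and minimal: "minimal_binomial_degree a (toric_ideal a :: ('m, 'k::field) mpoly set) b"
    and pq: "p \<noteq> q" "A_degree a p = A_degree a q" "A_degree a (w + p) = b"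
  shows "w = 0"
proof -
  have "A_degree a p \<in> binomial_degrees a (toric_ideal a :: ('m, 'k) mpoly set)"
    unfolding binomial_degrees_def binomial_of_degree_def
    using pq(1,2) binomial_in_toric_ideal[of p q a, where 'k = 'k] by auto
  moreover have "A_ge a b (A_degree a p)"
    unfolding A_ge_def NA_eq_range using pq(3) by (auto simp: add.commute)
  ultimately have "A_degree a p = b"
    using minimal unfolding minimal_binomial_degree_def by blast
  then show ?thesis
    using pq(3) A_degree_eq_zeroD[OF pointed nz] by simp
qed

text \<open>Only the trivial translation carries distinct exponents of equal degree into the fibre
  of \<open>b\<close>, so compatibility with addition puts no constraint on \<open>E\<close>. Any
  partition of the fibre yields an invariant for \<open>span_binomials_congruence\<close>.\<close>

lemma congruence_fibre:
  fixes a :: "'m::finite \<Rightarrow> int ^ 'n"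
  assumes "pointed (NA a)" "\<And>i. a i \<noteq> 0"
    and "minimal_binomial_degree a (toric_ideal a :: ('m, 'k::field) mpoly set) b"
    and E: "equivp E"
  shows "congruence (\<lambda>x y. A_degree a x = A_degree a y \<and> (A_degree a x = b \<longrightarrow> E x y))"
    (is "congruence ?R")
proof (rule congruenceI)
  fix w x y assume R: "?R x y"
  show "?R (w + x) (w + y)"
  proof (cases "x = y \<or> A_degree a (w + x) \<noteq> b")
    case True
    then show ?thesis
      using R equivp_reflp[OF E] by auto
  next
    case False
    then have "w = 0"
      using minimal_binomial_degreeD[OF assms(1-3)] R by blast
    then show ?thesis
      using R by simp
  qed
qed (use E in \<open>auto intro: equivp_reflp equivp_symp equivp_transp\<close>)

text \<open>Two such invariants are used: one shows that the fibre of \<open>b\<close> has only two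
  elements, the other that generators avoiding \<open>B\<close> and \<open>- B\<close> cannot
  connect them.\<close>

lemma indispensable_if_betti_number_eq_1:
  fixes a :: "'m::finite \<Rightarrow> int ^ 'n" and S :: "('m, 'k::field) mpoly set"
  assumes "pointed (NA a)" "\<And>i. a i \<noteq> 0"
    and "minimal_binomial_degree a (toric_ideal a :: ('m, 'k) mpoly set) b"
    and S: "binomial_generating_set (toric_ideal a) S"
    and "B \<in> S" "binomial_of_degree a b B" "betti_number a S b = 1"
  shows "indispensable (toric_ideal a) B"
proof -
  obtain u v where uv: "u \<noteq> v" "B = monomial u - monomial v" "A_degree a u = b" "A_degree a v = b"
    using assms(6) unfolding binomial_of_degree_def by blast
  have unique: "C = B" if "C \<in> S" "binomial_of_degree a b C" for C
    using assms(5-7) that unfolding betti_number_def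
    by (metis (mono_tags, lifting) card_1_singletonE mem_Collect_eq singletonD)
  have fibre: "w \<in> {u, v}" if w: "A_degree a w = b" for w
  proof -
    \<comment> \<open>\<open>B\<close> is the only generator of degree \<open>b\<close>, so gluing
      just \<open>u\<close> to \<open>v\<close> is respected by all of \<open>S\<close>; as
      \<open>S\<close> generates the toric ideal, the whole fibre must be glued to
      \<open>u\<close>.\<close>
    let ?E = "\<lambda>x y. x = y \<or> x \<in> {u, v} \<and> y \<in> {u, v}"
    let ?R = "\<lambda>x y. A_degree a x = A_degree a y \<and> (A_degree a x = b \<longrightarrow> ?E x y)"
    have "equivp ?E"
      by (intro equivpI reflpI sympI transpI) blast+
    then have "congruence ?R"
      by (rule congruence_fibre[OF assms(1-3)])
    moreover have "\<exists>p q. ?R p q \<and> C = monomial p - monomial q" if "C \<in> S" for C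
    proof -
      obtain p q where pq: "p \<noteq> q" "C = monomial p - monomial q" "A_degree a p = A_degree a q"
        using binomial_generating_setD[OF S \<open>C \<in> S\<close>] .
      have "{p, q} = {u, v}" if "A_degree a p = b"
      proof -
        have "binomial_of_degree a b C"
          using pq that unfolding binomial_of_degree_def by auto
        then have "C = B"
          by (rule unique[OF \<open>C \<in> S\<close>])
        then show ?thesis
          using binomial_eqD[OF pq(1)] pq(2) uv(2) by metis
      qed
      then show ?thesis
        using pq by blast
    qed
    moreover have "monomial w - monomial u \<in> ideal_generated S"
      using S w uv(3) unfolding binomial_generating_set_def by (simp add: binomial_in_toric_ideal)
    ultimately have "?R w u"
      by (rule span_binomials_congruence)
    then show ?thesis
      using w by blast
  qed
  have "B \<in> S' \<or> - B \<in> S'" if S': "binomial_generating_set (toric_ideal a) S'" for S'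
  proof (rule ccontr)
    assume notin: "\<not> (B \<in> S' \<or> - B \<in> S')"
    \<comment> \<open>Without \<open>B\<close> and \<open>- B\<close> no generator of degree
      \<open>b\<close> is left, so \<open>S'\<close> respects equality on the fibre, which separates
      \<open>u\<close> from \<open>v\<close>.\<close>
    let ?R = "\<lambda>x y. A_degree a x = A_degree a y \<and> (A_degree a x = b \<longrightarrow> x = y)"
    have "congruence ?R"
      by (rule congruence_fibre[OF assms(1-3) identity_equivp])
    moreover have "\<exists>p q. ?R p q \<and> C = monomial p - monomial q" if "C \<in> S'" for C
    proof -
      obtain p q where pq: "p \<noteq> q" "C = monomial p - monomial q" "A_degree a p = A_degree a q"
        using binomial_generating_setD[OF S' \<open>C \<in> S'\<close>] .
      have False if "A_degree a p = b"
      proof -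
        have "p \<in> {u, v}" "q \<in> {u, v}"
          using fibre that pq(3) by auto
        then have "C = B \<or> C = - B"
          using pq(1,2) uv(2) by auto
        then show False
          using notin \<open>C \<in> S'\<close> by auto
      qed
      then show ?thesis
        using pq by blast
    qed
    moreover have "monomial u - monomial v \<in> ideal_generated S'"
      using S' uv(3,4) unfolding binomial_generating_set_def by (simp add: binomial_in_toric_ideal)
    ultimately have "?R u v"
      by (rule span_binomials_congruence)
    then show False
      using uv by blast
  qed
  moreover have "B \<in> toric_ideal a" "is_binomial B"
    using S \<open>B \<in> S\<close> ideal.span_base by (auto simp: binomial_generating_set_def)
  ultimately show ?thesis
    unfolding indispensable_def by blast
qed

section \<open>Configurations containing the zero vector\<close>

lemma congruence_mod:
  "congruence (\<lambda>x y. Poly_Mapping.lookup x i mod n = Poly_Mapping.lookup y i mod (n::nat))"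
  by (rule congruenceI) (auto simp: lookup_add intro: mod_add_cong)

text \<open>
  The pair \<open>x\<^sub>i\<^sup>2 - 1\<close>, \<open>x\<^sub>i\<^sup>3 - 1\<close> generates \<open>x\<^sub>i - 1\<close>, but neither of them does so alone:
  the exponents of \<open>x\<^sub>i\<close> modulo 2 and modulo 3 are invariants.
\<close>

lemma zero_vector_betti_number:
  fixes a :: "'m::finite \<Rightarrow> int ^ 'n"
  assumes "a i = 0"
  obtains S :: "('m, 'k::field) mpoly set"
  where "minimal_generating_set (toric_ideal a) S" "betti_degree a (toric_ideal a :: ('m, 'k) mpoly set) 0"
    "betti_number a S 0 \<noteq> 1"
proof -
  let ?s = "Poly_Mapping.single i :: nat \<Rightarrow> 'm \<Rightarrow>\<^sub>0 nat"
  let ?P = "\<lambda>n. monomial (?s n) - monomial 0 :: ('m, 'k) mpoly"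
  \<comment> \<open>These generators keep the exponent of the \<open>i\<close>-th variable fixed, so
    they respect both residue invariants.\<close>
  let ?N = "{monomial u - monomial v :: ('m, 'k) mpoly |u v. u \<noteq> v \<and> A_degree a u = A_degree a v
    \<and> Poly_Mapping.lookup u i = Poly_Mapping.lookup v i}"
  define T where "T = insert (?P 2) (insert (?P 3) ?N)"
  have s_neq: "?s n \<noteq> 0" if "n \<noteq> 0" for n
    using that by (metis lookup_single_eq lookup_zero)
  have deg_s: "A_degree a (?s n) = 0" for n
    using assms by (simp add: A_degree_single)
  have P_toric: "?P n \<in> toric_ideal a" for n
    by (simp only: binomial_in_toric_ideal deg_s A_degree_zero)
  have P: "binomial_of_degree a 0 (?P n)" if "n \<noteq> 0" for n
    using s_neq[OF that] deg_s unfolding binomial_of_degree_def by fastforce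
  have "?P 2 \<noteq> ?P 3"
    using monomial_eq_iff[of "?s 2" "?s 3", where 'k = 'k] by (metis diff_add_cancel lookup_single_eq
        num.distinct(5) numeral_eq_iff)
  have base: "?P 2 \<in> ideal_generated T" "?P 3 \<in> ideal_generated T"
    by (auto simp: T_def intro: ideal.span_base)
  \<comment> \<open>For the \<open>i\<close>-th variable t: (t^3 - 1) - t (t^2 - 1) = t - 1.\<close>
  have "?s 1 + ?s 2 = ?s 3"
    by (simp add: numeral_3_eq_3 flip: single_add)
  then have "monomial (?s 3) - monomial (?s 1) \<in> ideal_generated T"
    using span_binomial_translate[OF base(1), of "?s 1"] by simp
  then have P1: "?P 1 \<in> ideal_generated T"
    using span_binomial_trans[OF span_binomial_sym base(2)] by blast
  have Pn: "?P n \<in> ideal_generated T" for n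
  proof (induction n)
    case (Suc n)
    have "?s n + ?s 1 = ?s (Suc n)"
      by (simp flip: single_add)
    then have "monomial (?s (Suc n)) - monomial (?s n) \<in> ideal_generated T"
      using span_binomial_translate[OF P1, of "?s n"] by simp
    then show ?case
      using span_binomial_trans[OF _ Suc] by blast
  qed (simp add: ideal.span_zero)
  have shift: "monomial (u + ?s n) - monomial u \<in> ideal_generated T" for u n
    using span_binomial_translate[OF Pn, of u n] by simp
  have "ideal_generated T = toric_ideal a"
  proof (rule span_eq_toric_idealI)
    show "T \<subseteq> toric_ideal a"
      using P_toric unfolding T_def by (auto simp: binomial_in_toric_ideal simp del: single_one)
  next
    fix u v :: "'m \<Rightarrow>\<^sub>0 nat"
    assume deg: "A_degree a u = A_degree a v"
    \<comment> \<open>Powers of the \<open>i\<close>-th variable equal 1 modulo \<open>T\<close>, so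
      \<open>u\<close> and \<open>v\<close> may be padded until both carry the sum of their
      \<open>i\<close>-th exponents; the padded difference lies in \<open>?N\<close> or
      vanishes.\<close>
    define u' where "u' = u + ?s (Poly_Mapping.lookup v i)"
    define v' where "v' = v + ?s (Poly_Mapping.lookup u i)"
    have "monomial u' - monomial v' \<in> ideal_generated T"
    proof (cases "u' = v'")
      case False
      moreover have "A_degree a u' = A_degree a v'" "Poly_Mapping.lookup u' i = Poly_Mapping.lookup v' i"
        using deg deg_s by (simp_all add: u'_def v'_def lookup_add)
      ultimately show ?thesis
        by (intro ideal.span_base) (auto simp: T_def)
    qed (simp add: ideal.span_zero)
    moreover have "monomial u - monomial u' \<in> ideal_generated T"
      unfolding u'_def by (rule span_binomial_sym[OF shift])
    moreover have "monomial v' - monomial v \<in> ideal_generated T"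
      unfolding v'_def by (rule shift)
    ultimately show "monomial u - monomial v \<in> ideal_generated T"
      by (meson span_binomial_trans)
  qed
  moreover have "is_binomial (?P n)" if "n \<noteq> 0" for n
    using P[OF that] by (auto simp: binomial_of_degree_def is_binomial_def)
  then have "is_binomial B" if "B \<in> T" for B
    using that unfolding T_def by (auto simp: is_binomial_def simp del: single_one)
  ultimately have "binomial_generating_set (toric_ideal a) T"
    unfolding binomial_generating_set_def by blast
  then obtain S where S: "finite S" "S \<subseteq> T" "minimal_generating_set (toric_ideal a) S"
    by (rule minimal_generating_set_exists)
  have span_S: "?P 1 \<in> ideal_generated S"
    using S(3) P_toric unfolding minimal_generating_set_def binomial_generating_set_def by blast
  \<comment> \<open>\<open>k\<close> belongs to the special binomial that may remain when
    \<open>?P n\<close> is missing: every generator then preserves the \<open>i\<close>-th exponent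
    modulo \<open>k\<close>, whereas \<open>?P 1\<close> changes it by 1.\<close>
  have needed: "?P n \<in> S" if n: "(n, k) = (2, 3) \<or> (n, k) = (3, 2)" for n k :: nat
  proof (rule ccontr)
    assume "?P n \<notin> S"
    let ?R = "\<lambda>x y. Poly_Mapping.lookup x i mod k = Poly_Mapping.lookup y i mod k"
    have "\<exists>u v. ?R u v \<and> B = monomial u - monomial v" if "B \<in> S" for B
    proof -
      consider "B \<in> ?N" | "B = ?P k"
        using \<open>B \<in> S\<close> \<open>?P n \<notin> S\<close> S(2) n unfolding T_def by blast
      then show ?thesis
      proof cases
        case 1
        then obtain u v where "B = monomial u - monomial v" "Poly_Mapping.lookup u i = Poly_Mapping.lookup v i"
          by blast
        then show ?thesis by metis
      next
        case 2
        moreover have "?R (?s k) 0"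
          by simp
        ultimately show ?thesis
          by (intro exI conjI)
      qed
    qed
    then have "?R (?s 1) 0"
      by (rule span_binomials_congruence[OF congruence_mod _ span_S])
    then show False
      using n by auto
  qed
  have in_S: "?P 2 \<in> S" "?P 3 \<in> S"
    by (rule needed; blast)+
  have P23: "binomial_of_degree a 0 (?P 2)" "binomial_of_degree a 0 (?P 3)"
    by (rule P, simp)+
  have "betti_degree a (toric_ideal a :: ('m, 'k) mpoly set) 0"
    unfolding betti_degree_def using S(3) in_S(1) P23(1) by blast
  moreover have "betti_number a S 0 \<noteq> 1"
  proof
    assume "betti_number a S 0 = 1"
    then obtain B where "{B \<in> S. binomial_of_degree a 0 B} = {B}"
      unfolding betti_number_def by (rule card_1_singletonE)
    moreover have "{?P 2, ?P 3} \<subseteq> {B \<in> S. binomial_of_degree a 0 B}"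
      using in_S P23 by blast
    ultimately have "{?P 2, ?P 3} \<subseteq> {B}"
      by (simp only:)
    then have "?P 2 = ?P 3"
      by (metis insert_subset singletonD)
    then show False
      using \<open>?P 2 \<noteq> ?P 3\<close> by contradiction
  qed
  ultimately show ?thesis
    by (rule that[OF S(3)])
qed

theorem theorem2p12:
  fixes a :: "'m::finite \<Rightarrow> int ^ 'n"
    and I :: "('m, 'k::field) mpoly set"
  assumes "pointed (NA a)"
    and "I = toric_ideal a"
  shows "ideal_generated {B. indispensable I B} = I \<longleftrightarrow>
    (\<forall>b. betti_degree a I b \<longrightarrow>
      minimal_binomial_degree a I b \<and>
      (\<forall>S. minimal_generating_set I S \<longrightarrow> betti_number a S b = 1))"
proof
  assume "ideal_generated {B. indispensable I B} = I"
  then show "\<forall>b. betti_degree a I b \<longrightarrow> minimal_binomial_degree a I b \<and>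
      (\<forall>S. minimal_generating_set I S \<longrightarrow> betti_number a S b = 1)"
    unfolding assms(2)
    using betti_degree_minimal_if_generated_by_indispensables
      betti_number_eq_1_if_generated_by_indispensables by blast
next
  assume betti: "\<forall>b. betti_degree a I b \<longrightarrow> minimal_binomial_degree a I b \<and>
      (\<forall>S. minimal_generating_set I S \<longrightarrow> betti_number a S b = 1)"
  \<comment> \<open>A zero vector would make 0 a Betti degree for which some minimal generating set
    has Betti number other than 1, against the assumption on all minimal generating sets.\<close>
  have nz: "a i \<noteq> 0" for i
    using zero_vector_betti_number[of a i, where 'k = 'k] betti assms(2) by metis
  obtain S :: "('m, 'k) mpoly set" where S: "minimal_generating_set I S"
    using minimal_generating_set_exists[OF binomial_generating_set_all] assms(2) by blast
  then have gen: "binomial_generating_set I S" and span_S: "ideal_generated S = I"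
    by (auto simp: minimal_generating_set_def binomial_generating_set_def)
  \<comment> \<open>\<open>S\<close> itself witnesses that the degree of \<open>B\<close> is a Betti
    degree, so the assumption supplies both its minimality and Betti number 1 in
    \<open>S\<close>.\<close>
  have "indispensable I B" if "B \<in> S" for B
  proof -
    obtain u v where "u \<noteq> v" "B = monomial u - monomial v" "A_degree a u = A_degree a v"
      using binomial_generating_setD[OF gen[unfolded assms(2)] \<open>B \<in> S\<close>] .
    then have deg: "binomial_of_degree a (A_degree a u) B"
      unfolding binomial_of_degree_def by auto
    then have "betti_degree a I (A_degree a u)"
      unfolding betti_degree_def using S \<open>B \<in> S\<close> by blast
    then show ?thesis
      using indispensable_if_betti_number_eq_1[OF assms(1) nz _ _ \<open>B \<in> S\<close> deg] betti S gen
      unfolding assms(2) by blast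
  qed
  then have "I \<subseteq> ideal_generated {B. indispensable I B}"
    using ideal.span_mono[of S] span_S by blast
  moreover have "ideal_generated {B. indispensable I B} \<subseteq> I"
    unfolding assms(2) by (rule span_subset_toric_ideal) (auto simp: indispensable_def)
  ultimately show "ideal_generated {B. indispensable I B} = I"
    by blast
qed

end
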